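(* Let $a_i>0$ for $1\le i\le r$ with $a_i\ne a_j$ whenever $i\ne j$, and let $C_{\vec n}$ be the multiple Charlier polynomials with parameters $(a_1,\ldots,a_r)$. Let $0<q_j<1$ for $1\le j\le r$ with $\sum_{j=1}^r q_j=1$, and for each positive integer $n$ let $\vec n=(n_1,\ldots,n_r)$ with $n_j=\lfloor q_jn\rfloor$. Let $x_{\vec n,1}<x_{\vec n,2}<\cdots<x_{\vec n,|\vec n|}$ be the zeros of $C_{\vec n}$, and let $t>0$. Then $$\lim_{n,N\to\infty,\ n/N\to t}\frac{1}{|\vec n|}\sum_{j=1}^{|\vec n|}f(x_{\vec n,j}/N)=\frac1t\int_0^t f(x)\,dx$$ for every bounded continuous function $f$ on $[0,\infty)$. (That is, the zeros of $C_{\vec n}(Nx)$ are asymptotically uniformly distributed on $[0,t]$ when $n,N\to\infty$ and $n/N\to t>0$.)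
   Context: For pairwise distinct $a_1,\ldots,a_r>0$ and a multi-index $\vec n=(n_1,\ldots,n_r)$ of non-negative integers with size $|\vec n|=n_1+\cdots+n_r$, the multiple Charlier polynomial $C_{\vec n}$ with parameters $(a_1,\ldots,a_r)$ is the (unique) monic polynomial of degree $|\vec n|$ such that $$\sum_{k=0}^\infty C_{\vec n}(k)\,k^\ell\,\frac{a_j^k}{k!}=0,\qquad \ell=0,1,\ldots,n_j-1,\quad j=1,\ldots,r$$ (with $k^0=1$ for all $k$, including $k=0$). Its zeros are all real, simple and lie in $(0,\infty)$. The limit is taken as the positive integers $n,N$ both tend to infinity in such a way that $n/N\to t$. *)

theory Defs
  imports "HOL-Analysis.Analysis" "HOL-Computational_Algebra.Polynomial"
begin

text \<open>
  Multi-indices \<open>(n\<^sub>1, \<dots>, n\<^sub>r)\<close> and parameters \<open>(a\<^sub>1, \<dots>, a\<^sub>r)\<close> are functions on \<open>nat\<close> of which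
  only the values on \<open>{1..r}\<close> are used.
\<close>

definition mi_size :: "nat \<Rightarrow> (nat \<Rightarrow> nat) \<Rightarrow> nat" where
  "mi_size r m = (\<Sum>j=1..r. m j)"

definition is_multiple_charlier ::
    "nat \<Rightarrow> (nat \<Rightarrow> real) \<Rightarrow> (nat \<Rightarrow> nat) \<Rightarrow> real poly \<Rightarrow> bool" where
  "is_multiple_charlier r a m p \<longleftrightarrow>
     lead_coeff p = 1 \<and> degree p = mi_size r m \<and>
     (\<forall>j\<in>{1..r}. \<forall>l<m j.
        (\<lambda>k. poly p (real k) * real k ^ l * (a j ^ k / fact k)) sums 0)"

text \<open>
  If the \<open>a j\<close> (\<open>1 \<le> j \<le> r\<close>) are positive and pairwise distinct, exactly one polynomial
  satisfies the description.
\<close>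

definition multiple_charlier ::
    "nat \<Rightarrow> (nat \<Rightarrow> real) \<Rightarrow> (nat \<Rightarrow> nat) \<Rightarrow> real poly" where
  "multiple_charlier r a m = (THE p. is_multiple_charlier r a m p)"

text \<open>
  The \<open>i\<close>-th smallest zero, for \<open>1 \<le> i \<le> mi_size r m\<close>; under the same conditions on \<open>a\<close> the
  polynomial has exactly \<open>mi_size r m\<close> zeros, all real and simple.
\<close>

definition multiple_charlier_zero ::
    "nat \<Rightarrow> (nat \<Rightarrow> real) \<Rightarrow> (nat \<Rightarrow> nat) \<Rightarrow> nat \<Rightarrow> real" where
  "multiple_charlier_zero r a m i =
     sorted_list_of_set {x. poly (multiple_charlier r a m) x = 0} ! (i - 1)"

definition floor_mi :: "(nat \<Rightarrow> real) \<Rightarrow> nat \<Rightarrow> nat \<Rightarrow> nat" where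
  "floor_mi q n j = nat \<lfloor>q j * real n\<rfloor>"

end

theory Submission
  imports Defs
begin

text \<open>
  The linear map \<open>U\<close> with \<open>U (y\<^sup>k) = x (x - 1) \<cdots> (x - k + 1)\<close> (\<open>umbral\<close> below) makes the
  multiple Charlier polynomials explicit; \<open>h\<close> is called the symbol of \<open>U h\<close>. The factorial moments of the Poisson weights give
  \<open>\<Sum>\<^sub>k (U h)(k) a\<^sup>k / k! = e\<^sup>a h(a)\<close>, and multiplication of \<open>U h\<close> by \<open>x\<close> corresponds to
  \<open>h \<mapsto> y (h + h')\<close>. Hence, for \<open>a \<noteq> 0\<close>, the polynomial \<open>U h\<close> is orthogonal to
  \<open>1, x, \<dots>, x\<^bsup>m - 1\<^esup>\<close> with respect to the weight \<open>a\<^sup>k / k!\<close> exactly when \<open>(y - a)\<^sup>m\<close> divides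
  \<open>h\<close>. Since \<open>U\<close> is bijective and preserves degree and leading coefficient, existence and
  uniqueness follow together, with \<open>C = U (\<Prod>\<^sub>j (y - a\<^sub>j)\<^bsup>n\<^sub>j\<^esup>)\<close>
  (\<open>multiple_charlier_eq_umbral\<close>).

  One more factor \<open>y - a\<close> turns \<open>P = U h\<close> into \<open>x P(x - 1) - a P(x)\<close>. If the zeros of \<open>P\<close> are
  positive with consecutive gaps larger than 1, the zeros \<open>0, x\<^sub>1 + 1, x\<^sub>2 + 1, \<dots>\<close> of
  \<open>x P(x - 1)\<close> strictly interlace those of \<open>P\<close>, and sign changes show that the new zeros
  again are positive with gaps larger than 1 (\<open>spaced_zeros_step\<close>). Meanwhile the second
  coefficient shows that the sum of the zeros of \<open>C\<close> is
  \<open>(0 + 1 + \<cdots> + (M - 1)) + \<Sum>\<^sub>j n\<^sub>j a\<^sub>j\<close>, where \<open>M\<close> is the degree.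

  So, counting from 0, the \<open>i\<close>-th zero exceeds \<open>i\<close>, while the sum of all these excesses is
  only \<open>O(M)\<close>. After division by \<open>N\<close> the mean distance between the zeros and the grid points
  \<open>i / N\<close> is \<open>O(1 / N)\<close>, so the mean of \<open>f\<close> over the rescaled zeros behaves like a Riemann sum
  over the grid (\<open>near_integers_equidistributed\<close>).
\<close>

section \<open>The umbral map\<close>

text \<open>
  Horner's scheme for the map that sends the power \<open>y\<^sup>k\<close> to the falling factorial
  \<open>x (x - 1) \<cdots> (x - k + 1)\<close>: multiplication by \<open>y\<close> becomes \<open>P(x) \<mapsto> x P(x - 1)\<close>.
\<close>

definition umbral :: "real poly \<Rightarrow> real poly" where
  "umbral h = fold_coeffs (\<lambda>c p. [:c:] + [:0, 1:] * (p \<circ>\<^sub>p [:-1, 1:])) h 0"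

lemma umbral_0 [simp]: "umbral 0 = 0"
  by (simp add: umbral_def)

lemma umbral_pCons: "umbral (pCons c h) = [:c:] + [:0, 1:] * (umbral h \<circ>\<^sub>p [:-1, 1:])"
  by (cases "c = 0 \<and> h = 0") (auto simp: umbral_def)

lemma umbral_add: "umbral (g + h) = umbral g + umbral h"
  by (induction g h rule: poly_induct2)
     (simp_all only: add_pCons umbral_pCons, simp_all add: pcompose_add algebra_simps)

lemma umbral_smult: "umbral (smult c h) = smult c (umbral h)"
  by (induction h) (simp_all add: umbral_pCons pcompose_smult smult_add_right)

lemma umbral_diff: "umbral (g - h) = umbral g - umbral h"
  using umbral_add[of g "smult (-1) h"] umbral_smult[of "-1" h] by simp

lemma umbral_const: "umbral [:c:] = [:c:]"
  by (simp add: umbral_pCons)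

lemma degree_shift: "degree (p \<circ>\<^sub>p [:c, 1:]) = degree (p :: real poly)"
  by (simp add: degree_pcompose)

lemma lead_coeff_shift: "lead_coeff (p \<circ>\<^sub>p [:c, 1:]) = lead_coeff (p :: real poly)"
  by (subst lead_coeff_comp) simp_all

lemma degree_lead_coeff_umbral:
  "degree (umbral h) = degree h \<and> lead_coeff (umbral h) = lead_coeff h"
proof (induction h)
  case (pCons c h)
  show ?case
  proof (cases "h = 0")
    case False
    define R where "R = umbral h \<circ>\<^sub>p [:-1, 1:]"
    have R: "degree R = degree h" "lead_coeff R = lead_coeff h"
      using pCons.IH lead_coeff_shift[of "umbral h" "-1"] degree_shift[of "umbral h" "-1"]
      unfolding R_def by argo+
    with False have "R \<noteq> 0" by (metis leading_coeff_0_iff)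
    moreover have "umbral (pCons c h) = pCons c R"
      by (simp add: umbral_pCons R_def)
    ultimately show ?thesis using R False by (simp add: coeff_pCons)
  qed (simp add: umbral_pCons)
qed simp

lemmas degree_umbral = degree_lead_coeff_umbral[THEN conjunct1]
  and lead_coeff_umbral = degree_lead_coeff_umbral[THEN conjunct2]

text \<open>
  Division of \<open>p\<close> by \<open>x\<close> with remainder, followed by the shift \<open>x \<mapsto> x + 1\<close>, inverts one step of
  the Horner scheme and lowers the degree.
\<close>

lemma surj_umbral: "\<exists>h. umbral h = p"
proof (induction "degree p" arbitrary: p rule: less_induct)
  case less
  show ?case
  proof (cases "degree p = 0")
    case True
    then obtain c where "p = [:c:]" by (metis degree_eq_zeroE)
    then show ?thesis using umbral_const by blast
  next
    case False
    obtain c R where p: "p = pCons c R" by (cases p)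
    with False have "degree (R \<circ>\<^sub>p [:1, 1:]) < degree p"
      by (auto simp: degree_shift split: if_splits)
    then obtain h where h: "umbral h = R \<circ>\<^sub>p [:1, 1:]" using less by blast
    have "umbral h \<circ>\<^sub>p [:-1, 1:] = R"
      by (simp add: h pcompose_pCons flip: pcompose_assoc)
    then have "umbral (pCons c h) = p" by (simp add: umbral_pCons p)
    then show ?thesis by blast
  qed
qed

text \<open>
  The right-hand side is the raising operator of the Charlier polynomials: adjoining a factor
  \<open>y - a\<close> raises the index that belongs to the parameter \<open>a\<close> by one.
\<close>

lemma umbral_mult_linear:
  "umbral ([:-a, 1:] * h) = [:0, 1:] * (umbral h \<circ>\<^sub>p [:-1, 1:]) - smult a (umbral h)"
proof -
  have "[:-a, 1:] * h = pCons 0 h - smult a h" by simp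
  then show ?thesis by (simp only: umbral_diff umbral_smult umbral_pCons) simp
qed

text \<open>
  On monomials this is the identity \<open>x \<cdot> (x)\<^sub>k = (x)\<^bsub>k+1\<^esub> + k (x)\<^sub>k\<close> for falling factorials
  \<open>(x)\<^sub>k\<close>. The induction moves along the Horner scheme instead and writes the factor \<open>x\<close> in front
  of \<open>P(x - 1)\<close> as \<open>(x - 1) + 1\<close>.
\<close>

lemma x_times_umbral: "[:0, 1:] * umbral h = umbral (pCons 0 (h + pderiv h))"
proof (induction h)
  case (pCons c h)
  define U where "U = umbral h"
  define E where "E = U \<circ>\<^sub>p [:-1, 1:]"
  have x: "[:0, 1:] = [:-1, 1:] + (1 :: real poly)" by (simp add: one_pCons)
  have "[:0, 1:] * E = ([:0, 1:] * U) \<circ>\<^sub>p [:-1, 1:] + E"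
    unfolding E_def by (subst (1) x) (simp add: pcompose_mult pcompose_pCons algebra_simps)
  also have "\<dots> = (umbral (pCons 0 (h + pderiv h)) + umbral h) \<circ>\<^sub>p [:-1, 1:]"
    using pCons(2) by (simp add: U_def E_def pcompose_add)
  finally have *: "[:0, 1:] * E = umbral (pCons 0 (h + pderiv h) + h) \<circ>\<^sub>p [:-1, 1:]"
    by (simp only: umbral_add)
  have K: "pCons c h + pderiv (pCons c h) = [:c:] + (pCons 0 (h + pderiv h) + h)"
    by (simp add: pderiv_pCons)
  have "[:0, 1:] * umbral (pCons c h) = [:0, 1:] * ([:c:] + [:0, 1:] * E)"
    by (simp add: umbral_pCons E_def U_def)
  also have "\<dots> = [:0, 1:] * (umbral ([:c:] + (pCons 0 (h + pderiv h) + h)) \<circ>\<^sub>p [:-1, 1:])"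
    unfolding * umbral_add[of "[:c:]"] umbral_const pcompose_add by simp
  also have "\<dots> = umbral (pCons 0 (pCons c h + pderiv (pCons c h)))"
    unfolding K umbral_pCons[of 0] by simp
  finally show ?case .
qed simp

section \<open>Moments with respect to the Poisson weights\<close>

text \<open>
  The factorial moments of the Poisson weights: multiplication of the symbol by \<open>y\<close> contributes a
  factor \<open>k\<close> that cancels against \<open>k!\<close>, and shifting the summation index pulls out one factor
  \<open>a\<close>.
\<close>

lemma umbral_moment:
  "(\<lambda>k. poly (umbral h) (real k) * (a ^ k / fact k)) sums (exp a * poly h a)"
proof (induction h)
  case (pCons c h)
  let ?g = "\<lambda>k. poly (umbral h) (real k) * (a ^ k / fact k)"
  let ?s = "\<lambda>k. real k * poly (umbral h) (real k - 1) * (a ^ k / fact k)"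
  have "(\<lambda>k. a * ?g k) sums (a * (exp a * poly h a))"
    using pCons by (intro sums_mult)
  moreover have "a * ?g k = ?s (Suc k)" for k
    by (simp add: field_simps del: of_nat_Suc) (simp add: algebra_simps)
  ultimately have "(\<lambda>k. ?s (Suc k)) sums (a * (exp a * poly h a))" by (simp only:)
  then have "?s sums (a * (exp a * poly h a) + ?s 0)" by (rule sums_Suc_iff[THEN iffD1])
  then have "?s sums (a * (exp a * poly h a))" by simp
  moreover have "(\<lambda>k. c * (a ^ k / fact k)) sums (c * exp a)"
    using exp_converges[of a] by (intro sums_mult) (simp add: divide_inverse mult.commute)
  ultimately have "(\<lambda>k. c * (a ^ k / fact k) + ?s k) sums (c * exp a + a * (exp a * poly h a))"
    by (intro sums_add)
  then show ?case
    by (simp add: umbral_pCons poly_pcompose algebra_simps)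
qed simp

text \<open>
  The action of multiplication by \<open>x\<close> on symbols. It is the Euler operator \<open>y d/dy\<close> conjugated by
  \<open>e\<^sup>y\<close>, because \<open>e\<^sup>y (h + h') = (e\<^sup>y h)'\<close>.
\<close>

definition euler_step :: "real poly \<Rightarrow> real poly" where
  "euler_step h = pCons 0 (h + pderiv h)"

lemma umbral_moment_power:
  "(\<lambda>k. poly (umbral h) (real k) * real k ^ l * (a ^ k / fact k)) sums
     (exp a * poly ((euler_step ^^ l) h) a)"
proof -
  have "umbral ((euler_step ^^ l) h) = [:0, 1:] ^ l * umbral h"
    by (induction l) (simp_all add: euler_step_def mult.assoc flip: x_times_umbral)
  then show ?thesis
    using umbral_moment[of "(euler_step ^^ l) h" a]
    by (simp add: poly_power mult.commute)
qed

lemma power_linear_dvd_cancel_left: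
  fixes a :: "'a :: idom"
  assumes "poly p a \<noteq> 0" "[:-a, 1:] ^ m dvd p * g"
  shows "[:-a, 1:] ^ m dvd g"
proof (cases "g = 0")
  case False
  have "order a (p * g) = order a p + order a g"
    using False assms by (intro order_mult) auto
  also have "order a p = 0" using assms by (intro order_0I)
  finally show ?thesis using assms False by (auto simp: order_divides)
qed simp

lemma prod_power_linear_dvd:
  fixes a :: "'b \<Rightarrow> 'a :: idom"
  assumes "finite S" "inj_on a S" "\<And>j. j \<in> S \<Longrightarrow> [:- a j, 1:] ^ m j dvd h"
  shows "(\<Prod>j\<in>S. [:- a j, 1:] ^ m j) dvd h"
  using assms
proof (induction S)
  case (insert i S)
  then obtain g where g: "h = (\<Prod>j\<in>S. [:- a j, 1:] ^ m j) * g" by auto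
  have "poly (\<Prod>j\<in>S. [:- a j, 1:] ^ m j) (a i) \<noteq> 0"
    using insert by (auto simp: poly_prod poly_power)
  moreover have "[:- a i, 1:] ^ m i dvd (\<Prod>j\<in>S. [:- a j, 1:] ^ m j) * g"
    using insert.prems(2)[of i] g by simp
  ultimately have "[:- a i, 1:] ^ m i dvd g" by (rule power_linear_dvd_cancel_left)
  then show ?case using insert g by (simp add: mult.commute mult_dvd_mono)
qed simp

text \<open>
  Away from 0, each application of \<open>euler_step\<close> lowers the order of a zero by exactly one: \<open>y\<close> is
  prime to \<open>y - a\<close>, and if \<open>h(a) = 0\<close> with \<open>h\<close> not zero, then \<open>h + h'\<close> vanishes at \<open>a\<close> to the
  same order as \<open>h'\<close>, which is one less than the order of \<open>h\<close>.
\<close>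

lemma euler_steps_vanish_iff:
  assumes "a \<noteq> 0"
  shows "(\<forall>l<m. poly ((euler_step ^^ l) h) a = 0) \<longleftrightarrow> [:-a, 1:] ^ m dvd h"
proof (induction m arbitrary: h)
  case (Suc m)
  have "(\<forall>l<Suc m. poly ((euler_step ^^ l) h) a = 0) \<longleftrightarrow>
      poly h a = 0 \<and> (\<forall>l<m. poly ((euler_step ^^ l) (euler_step h)) a = 0)"
    by (simp add: All_less_Suc2 funpow_swap1)
  also have "\<dots> \<longleftrightarrow> poly h a = 0 \<and> [:-a, 1:] ^ m dvd euler_step h"
    by (simp add: Suc)
  also have "\<dots> \<longleftrightarrow> [:-a, 1:] ^ Suc m dvd h"
  proof (cases "h = 0 \<or> poly h a \<noteq> 0")
    case True
    moreover have "poly h a = 0" if "[:-a, 1:] ^ Suc m dvd h"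
      using that by (metis dvd_trans dvd_triv_left poly_eq_0_iff_dvd power_Suc)
    ultimately show ?thesis
      by (auto simp: euler_step_def simp del: power_Suc)
  next
    case False
    then have ord: "order a h = Suc (order a (pderiv h))"
      by (intro order_pderiv) auto
    have pd: "pderiv h \<noteq> 0"
      using False by (metis degree_eq_zeroE pderiv_eq_0_iff poly_pCons poly_0 add.right_neutral
          mult_zero_right pCons_eq_0_iff)
    show ?thesis
    proof (intro iffI conjI)
      assume "[:-a, 1:] ^ Suc m dvd h"
      then have "m \<le> order a (pderiv h)" "m \<le> order a h"
        using False ord by (auto simp: order_divides simp del: power_Suc)
      then have "[:-a, 1:] ^ m dvd h + pderiv h" by (intro dvd_add) (auto simp: order_divides)
      then have "[:-a, 1:] ^ m dvd [:0, 1:] * (h + pderiv h)" by (rule dvd_mult)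
      then show "[:-a, 1:] ^ m dvd euler_step h" by (simp add: euler_step_def)
    next
      assume "poly h a = 0 \<and> [:-a, 1:] ^ m dvd euler_step h"
      then have *: "[:-a, 1:] ^ m dvd h + pderiv h"
        using assms power_linear_dvd_cancel_left[of "[:0, 1:]" a m "h + pderiv h"]
        by (simp add: euler_step_def)
      \<comment> \<open>Otherwise the zero of \<open>h + h'\<close> at \<open>a\<close> would have higher order than that of \<open>h'\<close>, as does
        the zero of \<open>h\<close>; then so would the difference \<open>h'\<close>.\<close>
      have "m \<le> order a (pderiv h)"
      proof (rule ccontr)
        assume "\<not> m \<le> order a (pderiv h)"
        then have "[:-a, 1:] ^ Suc (order a (pderiv h)) dvd h + pderiv h"
          using * by (meson dvd_trans le_imp_power_dvd not_less_eq_eq)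
        moreover have "[:-a, 1:] ^ Suc (order a (pderiv h)) dvd h"
          using ord order_1[of a h] by simp
        ultimately have "[:-a, 1:] ^ Suc (order a (pderiv h)) dvd pderiv h"
          using dvd_add_right_iff by blast
        with order_2[OF pd] show False by blast
      qed
      with ord show "[:-a, 1:] ^ Suc m dvd h" by (simp add: order_divides del: power_Suc)
    qed (use False in auto)
  qed
  finally show ?case .
qed simp

section \<open>Identification of the multiple Charlier polynomials\<close>

definition charlier_symbol :: "nat \<Rightarrow> (nat \<Rightarrow> real) \<Rightarrow> (nat \<Rightarrow> nat) \<Rightarrow> real poly" where
  "charlier_symbol r a m = (\<Prod>j=1..r. [:- a j, 1:] ^ m j)"

lemma degree_charlier_symbol: "degree (charlier_symbol r a m) = mi_size r m"
  unfolding charlier_symbol_def mi_size_def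
  by (subst degree_prod_sum_eq) (simp_all add: degree_power_eq)

lemma lead_coeff_charlier_symbol: "lead_coeff (charlier_symbol r a m) = 1"
  by (simp add: charlier_symbol_def lead_coeff_prod lead_coeff_power)

lemma is_multiple_charlier_umbral_iff:
  assumes "\<And>j. j \<in> {1..r} \<Longrightarrow> a j \<noteq> 0"
  shows "is_multiple_charlier r a m (umbral h) \<longleftrightarrow>
    lead_coeff h = 1 \<and> degree h = mi_size r m \<and> (\<forall>j\<in>{1..r}. [:- a j, 1:] ^ m j dvd h)"
proof -
  have "(\<lambda>k. poly (umbral h) (real k) * real k ^ l * (b ^ k / fact k)) sums 0 \<longleftrightarrow>
      poly ((euler_step ^^ l) h) b = 0" for l b
    using umbral_moment_power[of h l b] sums_unique2 by fastforce
  then show ?thesis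
    using assms unfolding is_multiple_charlier_def lead_coeff_umbral unfolding degree_umbral
    by (simp flip: euler_steps_vanish_iff)
qed

text \<open>
  The conditions on the symbol say that it is monic, of degree \<open>|n|\<close>, and divisible by all the
  pairwise coprime factors \<open>(y - a\<^sub>j)\<^bsup>n\<^sub>j\<^esup>\<close>. As the degrees of these add up to \<open>|n|\<close>, their
  product is the only possibility.
\<close>

theorem multiple_charlier_eq_umbral:
  assumes "\<And>j. j \<in> {1..r} \<Longrightarrow> a j \<noteq> 0"
    and "inj_on a {1..r}"
  shows "multiple_charlier r a m = umbral (charlier_symbol r a m)"
  unfolding multiple_charlier_def
proof (rule the_equality)
  have "[:- a j, 1:] ^ m j dvd charlier_symbol r a m" if "j \<in> {1..r}" for j
    unfolding charlier_symbol_def using that by (intro dvd_prodI) auto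
  then show "is_multiple_charlier r a m (umbral (charlier_symbol r a m))"
    using assms(1)
    by (subst is_multiple_charlier_umbral_iff)
       (use lead_coeff_charlier_symbol[of r a m] degree_charlier_symbol[of r a m] in auto)
next
  fix p assume p: "is_multiple_charlier r a m p"
  obtain h where h: "p = umbral h" using surj_umbral by metis
  have *: "lead_coeff h = 1" "degree h = mi_size r m"
    "\<forall>j\<in>{1..r}. [:- a j, 1:] ^ m j dvd h"
    using p is_multiple_charlier_umbral_iff[of r a m h] assms(1) unfolding h by blast+
  have "charlier_symbol r a m dvd h"
    unfolding charlier_symbol_def using * assms(2) by (intro prod_power_linear_dvd) auto
  then obtain g where g: "h = charlier_symbol r a m * g" by blast
  have "h \<noteq> 0" using *(1) by auto
  then have "degree h = degree (charlier_symbol r a m) + degree g"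
    unfolding g by (intro degree_mult_eq) auto
  then have "degree g = 0" using * degree_charlier_symbol by simp
  moreover have "lead_coeff g = 1"
    using *(1) unfolding g lead_coeff_mult lead_coeff_charlier_symbol by simp
  ultimately have "g = 1" by (metis degree_eq_zeroE lead_coeff_pCons(2) one_pCons)
  then show "p = umbral (charlier_symbol r a m)" by (simp add: h g)
qed

section \<open>Location of the zeros\<close>

definition spaced :: "nat \<Rightarrow> (nat \<Rightarrow> real) \<Rightarrow> bool" where
  "spaced m x \<longleftrightarrow> (\<forall>i<m. 0 < x i) \<and> (\<forall>i. Suc i < m \<longrightarrow> x i + 1 < x (Suc i))"

lemma spaced_gap:
  assumes "spaced m x" "i < j" "j < m"
  shows "x i + 1 < x j"
  using assms(2,3)
proof (induction j)
  case (Suc j)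
  have "x j + 1 < x (Suc j)" using assms(1) Suc.prems by (auto simp: spaced_def)
  then show ?case using Suc by (cases "i = j") auto
qed simp

lemma spaced_ge_index:
  assumes "spaced m x" "i < m"
  shows "real i < x i"
  using assms(2)
proof (induction i)
  case (Suc i)
  then show ?case using spaced_gap[OF assms(1), of i "Suc i"] by simp
qed (use assms in \<open>auto simp: spaced_def\<close>)

abbreviation monic_with_roots :: "nat \<Rightarrow> (nat \<Rightarrow> real) \<Rightarrow> real poly" where
  "monic_with_roots m x \<equiv> (\<Prod>i<m. [:- x i, 1:])"

lemma degree_monic_with_roots: "degree (monic_with_roots m x) = m"
  by (subst degree_prod_sum_eq) simp_all

lemma coeff_degree_monic_with_roots: "coeff (monic_with_roots m x) m = 1"
  using lead_coeff_prod[of "\<lambda>i. [:- x i, 1:]" "{..<m}"] unfolding degree_monic_with_roots by simp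

lemma subleading_coeff_monic_with_roots:
  "coeff (monic_with_roots (Suc m) x) m = - (\<Sum>i<Suc m. x i)"
proof (induction m)
  case (Suc m)
  have "coeff (monic_with_roots (Suc (Suc m)) x) (Suc m) =
      coeff (monic_with_roots (Suc m) x * [:- x (Suc m), 1:]) (Suc m)"
    by (subst prod.lessThan_Suc) (rule refl)
  also have "\<dots> = coeff (monic_with_roots (Suc m) x) m
      - x (Suc m) * coeff (monic_with_roots (Suc m) x) (Suc m)"
    by (simp add: mult.commute[of _ "[:_, _:]"])
  finally show ?case unfolding Suc.IH coeff_degree_monic_with_roots by simp
qed simp

text \<open>
  Put \<open>z\<^sub>0 = 0\<close> and \<open>z\<^sub>i = x\<^bsub>i-1\<^esub> + 1\<close>, the zeros of \<open>x P(x - 1)\<close>. Because of the gaps, both \<open>z\<^sub>i\<close>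
  and \<open>x\<^sub>i - 1\<close> lie strictly between \<open>x\<^bsub>i-1\<^esub>\<close> and \<open>x\<^sub>i\<close>, so \<open>P\<close> has the same sign at both
  points. Only the term \<open>- a P\<close> of \<open>Q\<close> survives at \<open>z\<^sub>i\<close> and only \<open>x\<^sub>i P(x\<^sub>i - 1)\<close> at \<open>x\<^sub>i\<close>, so
  \<open>Q\<close> changes sign on \<open>(z\<^sub>i, x\<^sub>i)\<close>; one further zero lies to the right of the last \<open>z\<^sub>i\<close>. These
  zeros \<open>y\<^sub>i\<close> satisfy \<open>y\<^sub>i + 1 < x\<^sub>i + 1 = z\<^bsub>i+1\<^esub> < y\<^bsub>i+1\<^esub>\<close>, so the gap condition is reproduced.
\<close>

lemma spaced_zeros_step:
  fixes x :: "nat \<Rightarrow> real" and m :: nat and a :: real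
  defines "P \<equiv> monic_with_roots m x"
  defines "Q \<equiv> [:0, 1:] * (P \<circ>\<^sub>p [:-1, 1:]) - smult a P"
  assumes sp: "spaced m x" and a: "a > 0"
  obtains y where "spaced (Suc m) y" "Q = monic_with_roots (Suc m) y"
    "(\<Sum>i<Suc m. y i) = (\<Sum>i<m. x i) + real m + a"
proof -
  define z where "z i = (case i of 0 \<Rightarrow> 0 | Suc j \<Rightarrow> x j + 1)" for i
  have z_simps [simp]: "z 0 = 0" "z (Suc i) = x i + 1" for i by (simp_all add: z_def)
  have shifted: "[:0, 1:] * (P \<circ>\<^sub>p [:-1, 1:]) = monic_with_roots (Suc m) z"
  proof -
    have "monic_with_roots (Suc m) z = [:0, 1:] * (\<Prod>i<m. [:- (x i + 1), 1:])"
      by (subst prod.lessThan_Suc_shift) simp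
    moreover have "P \<circ>\<^sub>p [:-1, 1:] = (\<Prod>i<m. [:- (x i + 1), 1:])"
      by (simp add: P_def pcompose_prod pcompose_pCons)
    ultimately show ?thesis by (simp only:)
  qed
  have Q: "Q = monic_with_roots (Suc m) z - smult a P" unfolding Q_def shifted by (rule refl)
  have poly_P: "poly P u = (\<Prod>i<m. u - x i)" for u by (simp add: P_def poly_prod)
  have P_root: "poly P (x i) = 0" if "i < m" for i using that by (auto simp: poly_P)
  have poly_Q: "poly Q u = u * poly P (u - 1) - a * poly P u" for u
    by (simp add: Q_def poly_pcompose)
  have Q_z: "poly Q (z i) = - a * poly P (z i)" if "i \<le> m" for i
    using that by (cases i) (auto simp: poly_Q P_root)
  have deg_P: "degree P = m" by (simp add: P_def degree_monic_with_roots)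
  have deg_Q: "degree Q \<le> Suc m"
    unfolding Q by (intro degree_diff_le) (simp_all only: degree_monic_with_roots, simp add: deg_P)
  have lead_Q: "coeff Q (Suc m) = 1"
    unfolding Q coeff_diff coeff_degree_monic_with_roots by (simp add: deg_P coeff_eq_0)
  have "\<exists>y. z i < y \<and> (i < m \<longrightarrow> y < x i) \<and> poly Q y = 0" if "i \<le> m" for i
  proof (cases "i < m")
    case True
    have pos: "0 < x i" using sp True by (auto simp: spaced_def)
    have less: "z i < x i"
      using sp True pos by (cases i) (auto simp: spaced_def)
    have "(z i - x k) * (x i - 1 - x k) > 0" if "k < m" for k
    proof (cases "k < i")
      case True
      then obtain j where j: "i = Suc j" by (cases i) auto
      have "x k < x j + 1" using spaced_gap[OF sp, of k j] True \<open>i < m\<close> j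
        by (cases "k = j") auto
      moreover have "x k + 1 < x i" using spaced_gap[OF sp True \<open>i < m\<close>] .
      ultimately show ?thesis by (simp add: j)
    next
      case False
      then have "x i \<le> x k" using spaced_gap[OF sp, of i k] that by (cases "k = i") auto
      then show ?thesis using less by (intro mult_neg_neg) auto
    qed
    then have "poly P (z i) * poly P (x i - 1) > 0"
      unfolding poly_P prod.distrib[symmetric] by (intro prod_pos) auto
    then have "a * x i * (poly P (z i) * poly P (x i - 1)) > 0" using a pos by simp
    then have "poly Q (z i) * poly Q (x i) < 0"
      using True by (simp add: Q_z) (simp add: poly_Q P_root algebra_simps)
    from poly_IVT[OF less this] show ?thesis by blast
  next
    case False
    with that have i: "i = m" by simp
    have "x k < z m" if km: "k < m" for k
    proof -
      obtain j where j: "m = Suc j" using km by (cases m) auto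
      then show ?thesis using spaced_gap[OF sp, of k j] km by (cases "k = j") auto
    qed
    then have "poly P (z m) > 0" unfolding poly_P by (intro prod_pos) auto
    then have neg: "poly Q (z m) < 0" using a by (simp add: Q_z)
    have "lead_coeff Q = 1"
      using deg_Q lead_Q by (metis le_antisym le_degree zero_neq_one)
    then obtain b where b: "\<And>u. u \<ge> b \<Longrightarrow> poly Q u \<ge> 1"
      using poly_pinfty_gt_lc[of Q] by auto
    have "poly Q (max b (z m + 1)) > 0" using b[of "max b (z m + 1)"] by simp
    moreover have "z m < max b (z m + 1)" by simp
    ultimately show ?thesis unfolding i using poly_IVT_pos[OF _ neg] by blast
  qed
  then have "\<forall>i. \<exists>y. i \<le> m \<longrightarrow> z i < y \<and> (i < m \<longrightarrow> y < x i) \<and> poly Q y = 0" by blast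
  from choice[OF this] obtain y where y: "\<And>i. i \<le> m \<Longrightarrow> z i < y i"
      "\<And>i. i < m \<Longrightarrow> y i < x i" "\<And>i. i \<le> m \<Longrightarrow> poly Q (y i) = 0"
    using less_imp_le_nat by blast
  have "0 < y 0" using y(1)[of 0] by simp
  have gap: "y i + 1 < y (Suc i)" if "Suc i < Suc m" for i
    using y(1)[of "Suc i"] y(2)[of i] that by simp
  have "0 < y i" if "i < Suc m" for i
    using that
  proof (induction i)
    case (Suc i)
    then show ?case using gap[of i] by simp
  qed (rule \<open>0 < y 0\<close>)
  with gap have sp_y: "spaced (Suc m) y" by (auto simp: spaced_def)
  have "inj_on y {..<Suc m}"
    by (rule linorder_inj_onI) (use spaced_gap[OF sp_y] in force)+
  then have card: "card (y ` {..<Suc m}) = Suc m" by (simp add: card_image)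
  have Q_y: "Q = monic_with_roots (Suc m) y"
  proof (rule poly_eqI_degree_lead_coeff)
    show "coeff Q (Suc m) = coeff (monic_with_roots (Suc m) y) (Suc m)"
      by (simp only: lead_Q coeff_degree_monic_with_roots)
    show "Suc m \<le> card (y ` {..<Suc m})" using card by simp
    show "degree (monic_with_roots (Suc m) y) \<le> Suc m"
      by (simp only: degree_monic_with_roots)
    fix u assume "u \<in> y ` {..<Suc m}"
    then obtain i where "i < Suc m" "u = y i" by blast
    moreover from this have "poly (monic_with_roots (Suc m) y) u = 0"
      unfolding poly_prod by (intro prod_zero) auto
    ultimately show "poly Q u = poly (monic_with_roots (Suc m) y) u"
      using y(3)[of i] by simp
  qed (rule deg_Q)
  have "coeff Q m = - (\<Sum>i<Suc m. z i) - a"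
    unfolding Q coeff_diff subleading_coeff_monic_with_roots coeff_smult
    by (simp add: P_def coeff_degree_monic_with_roots)
  moreover have "coeff Q m = - (\<Sum>i<Suc m. y i)"
    unfolding Q_y by (rule subleading_coeff_monic_with_roots)
  moreover have "(\<Sum>i<Suc m. z i) = (\<Sum>i<m. x i) + real m"
    by (subst sum.lessThan_Suc_shift) (simp add: sum.distrib)
  ultimately have "(\<Sum>i<Suc m. y i) = (\<Sum>i<m. x i) + real m + a" by linarith
  with sp_y Q_y show thesis by (rule that)
qed

text \<open>
  The number \<open>s\<close> is the total excess of the zeros over \<open>0, 1, 2, \<dots>\<close>, the zeros of the
  falling factorial of the same degree. It is recorded because each new factor \<open>y - a\<close> adds
  exactly \<open>a\<close> to it.
\<close>

definition umbral_spaced :: "real poly \<Rightarrow> real \<Rightarrow> bool" where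
  "umbral_spaced h s \<longleftrightarrow> (\<exists>x. spaced (degree h) x \<and> umbral h = monic_with_roots (degree h) x \<and>
     (\<Sum>i<degree h. x i) = (\<Sum>i<degree h. real i) + s)"

lemma umbral_spaced_mult_linear:
  assumes "umbral_spaced h s" "a > 0"
  shows "umbral_spaced ([:-a, 1:] * h) (s + a)"
proof -
  obtain x where x: "spaced (degree h) x" "umbral h = monic_with_roots (degree h) x"
      "(\<Sum>i<degree h. x i) = (\<Sum>i<degree h. real i) + s"
    using assms(1) by (auto simp: umbral_spaced_def)
  have "h \<noteq> 0" using x(2) by auto
  then have deg: "degree ([:-a, 1:] * h) = Suc (degree h)"
    by (subst degree_mult_eq) auto
  obtain y where y: "spaced (Suc (degree h)) y"
      "umbral ([:-a, 1:] * h) = monic_with_roots (Suc (degree h)) y"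
      "(\<Sum>i<Suc (degree h). y i) = (\<Sum>i<degree h. x i) + real (degree h) + a"
    unfolding umbral_mult_linear x(2) by (rule spaced_zeros_step[OF x(1) assms(2)])
  have "(\<Sum>i<Suc (degree h). y i) = (\<Sum>i<Suc (degree h). real i) + (s + a)"
    unfolding y(3) x(3) by simp
  with y(1,2) show ?thesis unfolding umbral_spaced_def deg by blast
qed

lemma umbral_spaced_mult_linear_power:
  assumes "umbral_spaced h s" "a > 0"
  shows "umbral_spaced ([:-a, 1:] ^ k * h) (s + real k * a)"
proof (induction k)
  case (Suc k)
  from umbral_spaced_mult_linear[OF this assms(2)] show ?case
    by (simp add: algebra_simps)
qed (use assms in simp)

lemma umbral_spaced_charlier_symbol:
  assumes "\<And>j. j \<in> {1..r} \<Longrightarrow> a j > 0"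
  shows "umbral_spaced (charlier_symbol r a m) (\<Sum>j=1..r. real (m j) * a j)"
  using assms
proof (induction r)
  case 0
  then show ?case
    by (simp add: umbral_spaced_def charlier_symbol_def spaced_def one_pCons umbral_const)
next
  case (Suc r)
  then have "umbral_spaced ([:- a (Suc r), 1:] ^ m (Suc r) * charlier_symbol r a m)
      ((\<Sum>j=1..r. real (m j) * a j) + real (m (Suc r)) * a (Suc r))"
    by (intro umbral_spaced_mult_linear_power) auto
  then show ?case by (simp add: charlier_symbol_def mult.commute)
qed

theorem multiple_charlier_zeros_spaced:
  fixes r a m
  defines "M \<equiv> mi_size r m" and "x \<equiv> (\<lambda>i. multiple_charlier_zero r a m (Suc i))"
  assumes a: "\<And>j. j \<in> {1..r} \<Longrightarrow> a j > 0" and inj: "inj_on a {1..r}"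
  shows "spaced M x"
    and "(\<Sum>i<M. x i) = (\<Sum>i<M. real i) + (\<Sum>j=1..r. real (m j) * a j)"
proof -
  obtain y where y: "spaced M y" "umbral (charlier_symbol r a m) = monic_with_roots M y"
      "(\<Sum>i<M. y i) = (\<Sum>i<M. real i) + (\<Sum>j=1..r. real (m j) * a j)"
    using umbral_spaced_charlier_symbol[of r a m, OF a]
    unfolding umbral_spaced_def degree_charlier_symbol M_def by blast
  have "a j \<noteq> 0" if "j \<in> {1..r}" for j using a[OF that] by simp
  then have C: "multiple_charlier r a m = monic_with_roots M y"
    using multiple_charlier_eq_umbral[of r a m] inj y(2) by metis
  have zeros: "{u. poly (multiple_charlier r a m) u = 0} = set (map y [0..<M])"
    by (auto simp: C poly_prod)
  have "sorted_wrt (<) (map y [0..<M])"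
    using spaced_gap[OF y(1)] by (force simp: sorted_wrt_map sorted_wrt_iff_nth_less)
  then have "sorted_list_of_set (set (map y [0..<M])) = map y [0..<M]"
    by (intro sorted_list_of_set.idem_if_sorted_distinct) (simp_all add: strict_sorted_iff)
  then have x: "x i = y i" if "i < M" for i
    using that by (simp add: x_def multiple_charlier_zero_def zeros del: set_map set_upt)
  from y(1) show "spaced M x" by (simp add: spaced_def x)
  from y(3) show "(\<Sum>i<M. x i) = (\<Sum>i<M. real i) + (\<Sum>j=1..r. real (m j) * a j)"
    by (simp add: x)
qed

section \<open>Equidistribution of nodes close to the integers\<close>

text \<open>
  The mean value theorem writes the integral as \<open>\<Sum> f(\<xi>\<^sub>i) / N\<close> with \<open>\<xi>\<^sub>i\<close> in
  \<open>[i / N, (i + 1) / N]\<close>, so that the distance of \<open>\<xi>\<^sub>i\<close> from \<open>x\<^sub>i / N\<close> is at most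
  \<open>(x\<^sub>i - i + 1) / N\<close>. If this bound is below \<open>\<delta>\<close>, the values of \<open>f\<close> differ by at most \<open>\<epsilon>\<close>;
  otherwise they differ by at most \<open>2 B\<close>, which is then dominated by
  \<open>2 B (x\<^sub>i - i + 1) / (\<delta> N)\<close>. The sum of both bounds is valid in either case, and
  the hypothesis on the total excess controls its sum over \<open>i\<close>.
\<close>

lemma sum_near_integers_minus_integral:
  fixes f :: "real \<Rightarrow> real" and x :: "nat \<Rightarrow> real" and m N :: nat
  assumes cont: "continuous_on {0..T} f"
    and unif: "\<And>u v. u \<in> {0..T} \<Longrightarrow> v \<in> {0..T} \<Longrightarrow> \<bar>u - v\<bar> < \<delta> \<Longrightarrow> \<bar>f u - f v\<bar> \<le> \<epsilon>"
    and bound: "\<And>u. u \<ge> 0 \<Longrightarrow> \<bar>f u\<bar> \<le> B"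
    and "N > 0" "\<delta> > 0" "\<epsilon> \<ge> 0" and T: "real m / real N + \<delta> \<le> T"
    and x: "\<And>i. i < m \<Longrightarrow> real i \<le> x i"
    and sum: "(\<Sum>i<m. x i) \<le> (\<Sum>i<m. real i) + A * real m"
  shows "\<bar>(\<Sum>i<m. f (x i / real N)) - real N * integral {0..real m / real N} f\<bar> \<le>
    real m * (\<epsilon> + 2 * B * (A + 1) / (\<delta> * real N))"
proof -
  define F where "F u = integral {0..u} f" for u
  have B: "B \<ge> 0" using bound[of 0] by simp
  have in_T: "real i / real N \<in> {0..T}" if "i \<le> m" for i
  proof -
    have "real i / real N \<le> real m / real N" using that \<open>N > 0\<close> by (simp add: divide_right_mono)
    then show ?thesis using T \<open>\<delta> > 0\<close> by simp
  qed
  have "\<exists>\<xi>. real i / real N \<le> \<xi> \<and> \<xi> \<le> real (Suc i) / real N \<and>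
      real N * (F (real (Suc i) / real N) - F (real i / real N)) = f \<xi>" if "i < m" for i
  proof -
    let ?a = "real i / real N" and ?b = "real (Suc i) / real N"
    have le: "?a \<le> ?b" using \<open>N > 0\<close> by (simp add: divide_right_mono)
    have sub: "{?a..?b} \<subseteq> {0..T}"
      using in_T[of i] in_T[of "Suc i"] that unfolding atLeastatMost_subset_iff by simp
    have "\<exists>\<xi>\<in>{?a..?b}. F ?b - F ?a = (\<lambda>h. h * f \<xi>) (?b - ?a)"
    proof (rule mvt_very_simple[OF le])
      fix u assume "?a \<le> u" "u \<le> ?b"
      then have "(F has_real_derivative f u) (at u within {0..T})"
        unfolding F_def using sub
        by (intro integral_has_real_derivative cont) (meson atLeastAtMost_iff subsetD)
      then have "(F has_real_derivative f u) (at u within {?a..?b})"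
        by (rule DERIV_subset) (rule sub)
      then show "(F has_derivative (\<lambda>h. h * f u)) (at u within {?a..?b})"
        by (simp add: has_field_derivative_def mult.commute[of _ "f u"])
    qed
    moreover have "?b - ?a = 1 / real N" by (simp add: diff_divide_distrib[symmetric])
    ultimately show ?thesis using \<open>N > 0\<close> by auto
  qed
  then obtain \<xi> where \<xi>: "\<And>i. i < m \<Longrightarrow> real i / real N \<le> \<xi> i"
      "\<And>i. i < m \<Longrightarrow> \<xi> i \<le> real (Suc i) / real N"
      "\<And>i. i < m \<Longrightarrow> real N * (F (real (Suc i) / real N) - F (real i / real N)) = f (\<xi> i)"
    by metis
  have "(\<Sum>i<m. f (\<xi> i)) = real N * (\<Sum>i<m. F (real (Suc i) / real N) - F (real i / real N))"
    by (simp only: sum_distrib_left) (use \<xi>(3) in simp)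
  also have "\<dots> = real N * F (real m / real N)"
    using sum_lessThan_telescope[of "\<lambda>i. F (real i / real N)" m] by (simp add: F_def)
  finally have int: "real N * integral {0..real m / real N} f = (\<Sum>i<m. f (\<xi> i))"
    by (simp add: F_def)
  define C where "C = 2 * B / (\<delta> * real N)"
  have C: "C \<ge> 0" using B \<open>\<delta> > 0\<close> by (simp add: C_def)
  have termwise: "\<bar>f (x i / real N) - f (\<xi> i)\<bar> \<le> \<epsilon> + C * (x i - real i + 1)" if i: "i < m" for i
  proof (cases "x i - real i + 1 < \<delta> * real N")
    case True
    have "\<xi> i \<in> {0..T}"
      using \<xi>(1,2)[OF i] in_T[of i] in_T[of "Suc i"] i unfolding atLeastAtMost_iff by linarith
    have x_div: "real i / real N \<le> x i / real N"
      using x[OF i] by (simp add: divide_right_mono)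
    have xi: "x i / real N < real i / real N + \<delta> - 1 / real N"
    proof -
      have "(x i - real i + 1) / real N < \<delta>" using True \<open>N > 0\<close> by (simp add: pos_divide_less_eq)
      then show ?thesis by (simp add: add_divide_distrib diff_divide_distrib)
    qed
    have "x i / real N \<in> {0..T}"
    proof -
      have "real i / real N \<le> real m / real N" using i by (simp add: divide_right_mono)
      moreover have "0 \<le> x i / real N" using x[OF i] by simp
      moreover have "1 / real N > 0" using \<open>N > 0\<close> by simp
      ultimately show ?thesis using xi T unfolding atLeastAtMost_iff by linarith
    qed
    have "\<bar>x i / real N - \<xi> i\<bar> < \<delta>"
    proof -
      have "real (Suc i) / real N = real i / real N + 1 / real N" by (simp add: add_divide_distrib)
      moreover have "1 / real N > 0" using \<open>N > 0\<close> by simp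
      moreover have "1 / real N < \<delta>"
        using True x[OF i] \<open>N > 0\<close> by (simp add: field_simps)
      ultimately show ?thesis using xi x_div \<xi>(1,2)[OF i] by linarith
    qed
    have "\<bar>f (x i / real N) - f (\<xi> i)\<bar> \<le> \<epsilon>" by (rule unif) fact+
    moreover have "0 \<le> C * (x i - real i + 1)" using C x[OF i] by simp
    ultimately show ?thesis by linarith
  next
    case False
    have "0 \<le> real i / real N" by simp
    then have "0 \<le> \<xi> i" "0 \<le> x i / real N" using \<xi>(1)[OF i] x[OF i] by (linarith, simp)
    then have "\<bar>f (x i / real N) - f (\<xi> i)\<bar> \<le> 2 * B"
      using bound[of "\<xi> i"] bound[of "x i / real N"] by linarith
    also have "2 * B = C * (\<delta> * real N)" using \<open>\<delta> > 0\<close> \<open>N > 0\<close> by (simp add: C_def)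
    also have "\<dots> \<le> C * (x i - real i + 1)" using False C by (intro mult_left_mono) auto
    finally show ?thesis using \<open>\<epsilon> \<ge> 0\<close> by linarith
  qed
  have "\<bar>(\<Sum>i<m. f (x i / real N)) - (\<Sum>i<m. f (\<xi> i))\<bar> \<le>
      (\<Sum>i<m. \<bar>f (x i / real N) - f (\<xi> i)\<bar>)"
    by (simp only: sum_subtractf[symmetric] sum_abs)
  also have "\<dots> \<le> (\<Sum>i<m. \<epsilon> + C * (x i - real i + 1))" by (intro sum_mono termwise) auto
  also have "\<dots> = real m * \<epsilon> + C * ((\<Sum>i<m. x i) - (\<Sum>i<m. real i) + real m)"
    by (simp add: sum.distrib sum_subtractf flip: sum_distrib_left)
  also have "\<dots> \<le> real m * \<epsilon> + C * ((A + 1) * real m)"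
    using sum C by (intro add_left_mono mult_left_mono) (simp_all add: algebra_simps)
  also have "\<dots> = real m * (\<epsilon> + 2 * B * (A + 1) / (\<delta> * real N))"
    by (simp add: C_def algebra_simps)
  finally show ?thesis by (simp only: int)
qed

text \<open>
  Dividing the preceding estimate by \<open>m\<close> leaves \<open>\<epsilon> + O(1 / N)\<close>, and
  \<open>(N / m) \<integral>\<^sub>0\<^bsup>m/N\<^esup> f\<close> tends to \<open>(1 / t) \<integral>\<^sub>0\<^sup>t f\<close> since the integral is continuous in its upper
  limit.
\<close>

theorem near_integers_equidistributed:
  fixes f :: "real \<Rightarrow> real" and x :: "nat \<Rightarrow> nat \<Rightarrow> real" and m N :: "nat \<Rightarrow> nat"
  assumes "t > 0" and N: "filterlim N at_top sequentially"
    and ratio: "(\<lambda>k. real (m k) / real (N k)) \<longlonglongrightarrow> t"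
    and cont: "continuous_on {0..} f" and bdd: "bounded (f ` {0..})"
    and x: "\<And>k i. i < m k \<Longrightarrow> real i \<le> x k i"
    and sum: "\<And>k. (\<Sum>i<m k. x k i) \<le> (\<Sum>i<m k. real i) + A * real (m k)"
  shows "(\<lambda>k. 1 / real (m k) * (\<Sum>i<m k. f (x k i / real (N k)))) \<longlonglongrightarrow> 1 / t * integral {0..t} f"
proof -
  \<comment> \<open>Eventually \<open>m / N < t + 1\<close>, and the modulus \<open>\<delta>\<close> will be at most 1.\<close>
  define T where "T = t + 2"
  define \<rho> where "\<rho> k = real (m k) / real (N k)" for k
  have contT: "continuous_on {0..T} f" by (rule continuous_on_subset[OF cont]) auto
  obtain B where B: "\<And>u. u \<ge> 0 \<Longrightarrow> \<bar>f u\<bar> \<le> B"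
    using bdd by (auto simp: bounded_iff)
  have \<rho>: "\<rho> \<longlonglongrightarrow> t" using ratio by (simp add: \<rho>_def[abs_def])
  have ev_N: "\<forall>\<^sub>F k in sequentially. N k > 0"
    using N unfolding filterlim_at_top Suc_le_eq[symmetric] by blast
  have ev_\<rho>: "\<forall>\<^sub>F k in sequentially. 0 < \<rho> k \<and> \<rho> k < t + 1"
    using order_tendstoD[OF \<rho>] \<open>t > 0\<close> by (auto intro!: eventually_conj)
  have invN: "(\<lambda>k. 1 / real (N k)) \<longlonglongrightarrow> 0"
    using filterlim_compose[OF lim_1_over_n N] by simp
  have "isCont (\<lambda>u. integral {0..u} f) t"
  proof -
    have "((\<lambda>u. integral {0..u} f) has_real_derivative f t) (at t within {0..T})"
      using \<open>t > 0\<close> by (intro integral_has_real_derivative contT) (auto simp: T_def)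
    moreover have "at t within {0..T} = at t"
      using \<open>t > 0\<close> by (intro at_within_interior) (auto simp: T_def)
    ultimately show ?thesis using DERIV_isCont by metis
  qed
  then have "(\<lambda>k. integral {0..\<rho> k} f) \<longlonglongrightarrow> integral {0..t} f"
    by (rule isCont_tendsto_compose[OF _ \<rho>])
  then have main: "(\<lambda>k. 1 / \<rho> k * integral {0..\<rho> k} f) \<longlonglongrightarrow> 1 / t * integral {0..t} f"
    using \<open>t > 0\<close> by (intro tendsto_mult tendsto_divide[OF tendsto_const \<rho>]) auto
  have "(\<lambda>k. 1 / real (m k) * (\<Sum>i<m k. f (x k i / real (N k))) - 1 / \<rho> k * integral {0..\<rho> k} f)
      \<longlonglongrightarrow> 0"
  proof (rule tendstoI)
    fix e :: real assume "e > 0"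
    have "uniformly_continuous_on {0..T} f"
      using contT by (rule compact_uniformly_continuous) simp
    then obtain \<delta>' where \<delta>': "\<delta>' > 0"
      "\<And>u v. u \<in> {0..T} \<Longrightarrow> v \<in> {0..T} \<Longrightarrow> dist v u < \<delta>' \<Longrightarrow> dist (f v) (f u) < e / 2"
      using \<open>e > 0\<close> unfolding uniformly_continuous_on_def by (metis half_gt_zero)
    define \<delta> where "\<delta> = min \<delta>' 1"
    have \<delta>: "\<delta> > 0" "\<delta> \<le> 1" using \<delta>'(1) by (auto simp: \<delta>_def)
    have unif: "\<bar>f u - f v\<bar> \<le> e / 2"
      if "u \<in> {0..T}" "v \<in> {0..T}" "\<bar>u - v\<bar> < \<delta>" for u v
      using \<delta>'(2)[of v u] that by (simp add: dist_real_def \<delta>_def)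
    have "(\<lambda>k. 2 * B * (A + 1) / \<delta> * (1 / real (N k))) \<longlonglongrightarrow> 2 * B * (A + 1) / \<delta> * 0"
      by (intro tendsto_intros invN)
    then have "\<forall>\<^sub>F k in sequentially. 2 * B * (A + 1) / \<delta> * (1 / real (N k)) < e / 2"
      by (rule order_tendstoD) (use \<open>e > 0\<close> in simp)
    with ev_N ev_\<rho>
    show "\<forall>\<^sub>F k in sequentially. dist (1 / real (m k) * (\<Sum>i<m k. f (x k i / real (N k)))
        - 1 / \<rho> k * integral {0..\<rho> k} f) 0 < e"
    proof eventually_elim
      case (elim k)
      then have mk: "real (m k) > 0" by (auto simp: \<rho>_def zero_less_divide_iff)
      have *: "\<bar>(\<Sum>i<m k. f (x k i / real (N k))) - real (N k) * integral {0..\<rho> k} f\<bar>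
          \<le> real (m k) * (e / 2 + 2 * B * (A + 1) / (\<delta> * real (N k)))"
        unfolding \<rho>_def
        by (rule sum_near_integers_minus_integral[OF contT unif B])
           (use elim \<delta> \<open>e > 0\<close> x sum in \<open>auto simp: \<rho>_def T_def\<close>)
      have "1 / real (m k) * (\<Sum>i<m k. f (x k i / real (N k))) - 1 / \<rho> k * integral {0..\<rho> k} f
          = ((\<Sum>i<m k. f (x k i / real (N k))) - real (N k) * integral {0..\<rho> k} f) / real (m k)"
        by (simp add: \<rho>_def diff_divide_distrib)
      then have "\<bar>1 / real (m k) * (\<Sum>i<m k. f (x k i / real (N k)))
          - 1 / \<rho> k * integral {0..\<rho> k} f\<bar> \<le> e / 2 + 2 * B * (A + 1) / (\<delta> * real (N k))"
        using * mk by (simp add: abs_divide pos_divide_le_eq mult.commute)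
      also have "\<dots> < e" using elim by simp
      finally show ?case by simp
    qed
  qed
  from tendsto_add[OF this main] show ?thesis by simp
qed

section \<open>The limit distribution of the zeros\<close>

lemma mi_size_floor_mi_bounds:
  assumes "\<And>j. j \<in> {1..r} \<Longrightarrow> 0 \<le> q j" and "(\<Sum>j=1..r. q j) = 1"
  shows "real n - real r \<le> real (mi_size r (floor_mi q n))"
    and "real (mi_size r (floor_mi q n)) \<le> real n"
proof -
  have n: "real n = (\<Sum>j=1..r. q j * real n)"
    using assms(2) by (simp flip: sum_distrib_right)
  have *: "q j * real n - 1 \<le> real (floor_mi q n j) \<and> real (floor_mi q n j) \<le> q j * real n"
    if "j \<in> {1..r}" for j
    using assms(1)[OF that] unfolding floor_mi_def by (simp; linarith)
  have "real n - real r = (\<Sum>j=1..r. q j * real n - 1)"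
    by (subst n) (simp add: sum_subtractf)
  also have "\<dots> \<le> real (mi_size r (floor_mi q n))"
    unfolding mi_size_def of_nat_sum using * by (intro sum_mono) blast
  finally show "real n - real r \<le> real (mi_size r (floor_mi q n))" .
  show "real (mi_size r (floor_mi q n)) \<le> real n"
    unfolding mi_size_def of_nat_sum by (subst n, intro sum_mono) (use * in blast)
qed

theorem theorem4p1:
  fixes r :: nat and a q :: "nat \<Rightarrow> real" and t :: real
    and n N :: "nat \<Rightarrow> nat" and f :: "real \<Rightarrow> real"
  assumes "\<And>i. i \<in> {1..r} \<Longrightarrow> a i > 0"
    and "\<And>i j. i \<in> {1..r} \<Longrightarrow> j \<in> {1..r} \<Longrightarrow> i \<noteq> j \<Longrightarrow> a i \<noteq> a j"
    and "\<And>j. j \<in> {1..r} \<Longrightarrow> 0 < q j \<and> q j < 1"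
    and "(\<Sum>j=1..r. q j) = 1"
    and "t > 0"
    and "filterlim n at_top sequentially"
    and "filterlim N at_top sequentially"
    and "(\<lambda>k. real (n k) / real (N k)) \<longlonglongrightarrow> t"
    and "continuous_on {0..} f"
    and "bounded (f ` {0..})"
  shows "(\<lambda>k. 1 / real (mi_size r (floor_mi q (n k))) *
            (\<Sum>j=1..mi_size r (floor_mi q (n k)).
               f (multiple_charlier_zero r a (floor_mi q (n k)) j / real (N k))))
         \<longlonglongrightarrow> 1 / t * integral {0..t} f"
proof -
  define m where "m k = mi_size r (floor_mi q (n k))" for k
  define x where "x k i = multiple_charlier_zero r a (floor_mi q (n k)) (Suc i)" for k i
  define A where "A = (\<Sum>j=1..r. a j)"
  have inj: "inj_on a {1..r}" using assms(2) by (meson inj_onI)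
  have spaced: "spaced (m k) (x k)" for k
    unfolding m_def x_def by (rule multiple_charlier_zeros_spaced(1)[OF assms(1) inj])
  have bounds: "real (n k) - real r \<le> real (m k)" "real (m k) \<le> real (n k)" for k
    using mi_size_floor_mi_bounds[of r q] assms(3,4) less_imp_le unfolding m_def by blast+
  have "(\<lambda>k. 1 / real (N k)) \<longlonglongrightarrow> 0"
    using filterlim_compose[OF lim_1_over_n assms(7)] by simp
  then have "(\<lambda>k. real (n k) / real (N k) - real r * (1 / real (N k))) \<longlonglongrightarrow> t - real r * 0"
    by (intro tendsto_intros assms(8))
  then have lower: "(\<lambda>k. (real (n k) - real r) / real (N k)) \<longlonglongrightarrow> t"
    by (simp add: diff_divide_distrib)
  \<comment> \<open>Rounding the \<open>q\<^sub>j n\<close> down loses at most \<open>r\<close> in total, which is negligible against \<open>N\<close>.\<close>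
  have ratio: "(\<lambda>k. real (m k) / real (N k)) \<longlonglongrightarrow> t"
    by (rule tendsto_sandwich[OF _ _ lower assms(8)])
       (auto intro!: always_eventually divide_right_mono bounds)
  have "(\<Sum>i<m k. x k i) \<le> (\<Sum>i<m k. real i) + A * real (m k)" for k
  proof -
    have "a j \<le> A" if "j \<in> {1..r}" for j
      unfolding A_def using that assms(1) by (intro member_le_sum) (auto intro: less_imp_le)
    then have "(\<Sum>j=1..r. real (floor_mi q (n k) j) * a j) \<le>
        (\<Sum>j=1..r. real (floor_mi q (n k) j) * A)"
      by (intro sum_mono mult_left_mono) auto
    also have "\<dots> = A * real (m k)"
      unfolding m_def mi_size_def of_nat_sum sum_distrib_right[symmetric] by (rule mult.commute)
    finally show ?thesis
      unfolding m_def x_def using multiple_charlier_zeros_spaced(2)[OF assms(1) inj] by simp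
  qed
  moreover have "real i \<le> x k i" if "i < m k" for k i
    using spaced_ge_index[OF spaced that] by simp
  ultimately have "(\<lambda>k. 1 / real (m k) * (\<Sum>i<m k. f (x k i / real (N k)))) \<longlonglongrightarrow> 1 / t * integral {0..t} f"
    by (intro near_integers_equidistributed[OF assms(5,7) ratio assms(9,10)])
  then show ?thesis
    unfolding m_def x_def by (simp add: sum.atLeast1_atMost_eq)
qed

end
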